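(* A finite poset $L$ is a semidistributive lattice if and only if it is isomorphic to $\operatorname{Pairs}(\to)$ for a finite two-acyclic factorization system $(S,\to,\twoheadrightarrow,\hookrightarrow)$. In this case, $(S,\to,\twoheadrightarrow,\hookrightarrow)$ and $(\operatorname{Ji}L,\to_L,\twoheadrightarrow_L,\hookrightarrow_L)$ are isomorphic (there is a bijection of underlying sets carrying each relation to the corresponding relation). The map $$x\mapsto\bigl(\{j\in\operatorname{Ji}L: j\le x\},\ \kappa^d(\{m\in\operatorname{Mi}L: m\ge x\})\bigr)$$ is an isomorphism from $L$ to $\operatorname{Pairs}(\to_L)$, with inverse $(X,Y)\mapsto\bigvee X=\bigwedge\kappa(Y)$.
   Context: Lattices: A lattice $L$ is join semidistributive if $x\vee y=x\vee z$ implies $x\vee(y\wedge z)=x\vee y$; meet semidistributive if $x\wedge y=x\wedge z$ implies $x\wedge(y\vee z)=x\wedge y$; semidistributive if both. Finite lattices are complete (in particular nonempty). For a finite lattice $L$, $\operatorname{Ji}L$ is the set of join-irreducible elements (those covering exactly one element; the element covered by $j$ is $j_*$), and $\operatorname{Mi}L$ is the set of meet-irreducible elements (those covered by exactly one element; the element covering $m$ is $m^*$). In a finite semidistributive lattice, for $j\in\operatorname{Ji}L$ the set $\{y: j\wedge y=j_*\}$ has a maximum element $\kappa(j)$, and for $m\in\operatorname{Mi}L$ the set $\{x: m\vee x=m^*\}$ has a minimum element $\kappa^d(m)$; $\kappa:\operatorname{Ji}L\to\operatorname{Mi}L$ and $\kappa^d:\operatorname{Mi}L\to\operatorname{Ji}L$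 are inverse bijections. For a finite semidistributive lattice $L$ define relations on $\operatorname{Ji}L$: $i\to_L j$ iff $i\not\le\kappa(j)$; $i\twoheadrightarrow_L j$ iff $i\ge j$; $i\hookrightarrow_L j$ iff $\kappa(i)\ge\kappa(j)$. Factorization systems: For a binary relation $\to$ on a set $S$ and $X\subseteq S$, put $X^\perp=\{y\in S: x\not\to y\ \forall x\in X\}$ and ${}^\perp X=\{y\in S: y\not\to x\ \forall x\in X\}$. A maximal orthogonal pair is a pair $(X,Y)$ of subsets of $S$ with $Y=X^\perp$ and $X={}^\perp Y$. $\operatorname{Pairs}(\to)$ is the set of maximal orthogonal pairs, partially ordered by containment of first components (equivalently reverse containment of second components). For a reflexive relation $\to$ on $S$, $\operatorname{Fact}(\to)=(\twoheadrightarrow,\hookrightarrow)$, where $x\twoheadrightarrow y$ iff for all $z$, $y\to z$ implies $x\to z$, and $x\hookrightarrow y$ iff for all $z$, $z\to x$ implies $z\to y$. For preorders $\twoheadrightarrow,\hookrightarrow$ on $S$, $\operatorname{Mult}(\twoheadrightarrow,\hookrightarrow)$ is the relation relating $x$ to $z$ iff there is $y\in S$ with $x\twoheadrightarrow y\hookrightarrow z$. A factorization system is a tuple $(S,\to,\twoheadrightarrow,\hookrightarrow)$ with $\to$ a reflexive relation on $S$, $\operatorname{Fact}(\to)=(\twoheadrightarrow,\hookrightarrow)$ and $\operatorname{Mult}(\twoheadrightarrow,\hookrightarrow)=\to$. It is finite if $S$ is finite. It is two-acyclic if it satisfies the order condition ($x\twoheadrightarrow y\twoheadrightarrow x$ implies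 $x=y$, and $x\hookrightarrow y\hookrightarrow x$ implies $x=y$) and the brick condition ($x\twoheadrightarrow y\hookrightarrow x$ implies $x=y$). *)

theory Defs
  imports "HOL-Algebra.Complete_Lattice"
begin

text \<open>Lattices are those of \<^theory>\<open>HOL-Algebra.Lattice\<close>. A poset is a record satisfying
  \<^const>\<open>partial_order\<close>, for which the equality of the record is HOL equality.\<close>

definition order_iso :: "('a, 'c) gorder_scheme \<Rightarrow> ('b, 'd) gorder_scheme \<Rightarrow> ('a \<Rightarrow> 'b) \<Rightarrow> bool" where
  "order_iso L M f \<longleftrightarrow> order_emb L M f \<and> bij_betw f (carrier L) (carrier M)"

definition order_isomorphic :: "('a, 'c) gorder_scheme \<Rightarrow> ('b, 'd) gorder_scheme \<Rightarrow> bool" where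
  "order_isomorphic L M \<longleftrightarrow> (\<exists>f. order_iso L M f)"

definition join_semidistributive :: "('a, 'c) gorder_scheme \<Rightarrow> bool" where
  "join_semidistributive L \<longleftrightarrow>
    (\<forall>x\<in>carrier L. \<forall>y\<in>carrier L. \<forall>z\<in>carrier L.
      x \<squnion>\<^bsub>L\<^esub> y = x \<squnion>\<^bsub>L\<^esub> z \<longrightarrow> x \<squnion>\<^bsub>L\<^esub> (y \<sqinter>\<^bsub>L\<^esub> z) = x \<squnion>\<^bsub>L\<^esub> y)"

definition meet_semidistributive :: "('a, 'c) gorder_scheme \<Rightarrow> bool" where
  "meet_semidistributive L \<longleftrightarrow>
    (\<forall>x\<in>carrier L. \<forall>y\<in>carrier L. \<forall>z\<in>carrier L.
      x \<sqinter>\<^bsub>L\<^esub> y = x \<sqinter>\<^bsub>L\<^esub> z \<longrightarrow> x \<sqinter>\<^bsub>L\<^esub> (y \<squnion>\<^bsub>L\<^esub> z) = x \<sqinter>\<^bsub>L\<^esub> y)"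

text \<open>The locale \<^locale>\<open>lattice\<close> admits the empty carrier, so nonemptiness has to be required.\<close>

definition semidistributive_lattice :: "('a, 'c) gorder_scheme \<Rightarrow> bool" where
  "semidistributive_lattice L \<longleftrightarrow>
    lattice L \<and> carrier L \<noteq> {} \<and> join_semidistributive L \<and> meet_semidistributive L"

text \<open>\<open>covered_by L x y\<close>: the element \<open>y\<close> covers the element \<open>x\<close>.\<close>

definition covered_by :: "('a, 'c) gorder_scheme \<Rightarrow> 'a \<Rightarrow> 'a \<Rightarrow> bool" where
  "covered_by L x y \<longleftrightarrow> x \<in> carrier L \<and> y \<in> carrier L \<and> x \<sqsubset>\<^bsub>L\<^esub> y \<and>
    \<not> (\<exists>z\<in>carrier L. x \<sqsubset>\<^bsub>L\<^esub> z \<and> z \<sqsubset>\<^bsub>L\<^esub> y)"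

definition Ji :: "('a, 'c) gorder_scheme \<Rightarrow> 'a set" where
  "Ji L = {j \<in> carrier L. \<exists>!x. covered_by L x j}"

definition Mi :: "('a, 'c) gorder_scheme \<Rightarrow> 'a set" where
  "Mi L = {m \<in> carrier L. \<exists>!y. covered_by L m y}"

definition lower_cover :: "('a, 'c) gorder_scheme \<Rightarrow> 'a \<Rightarrow> 'a" where
  "lower_cover L j = (THE x. covered_by L x j)"

definition upper_cover :: "('a, 'c) gorder_scheme \<Rightarrow> 'a \<Rightarrow> 'a" where
  "upper_cover L m = (THE y. covered_by L m y)"

text \<open>These are meaningful for \<open>j \<in> Ji L\<close> and \<open>m \<in> Mi L\<close> in a finite semidistributive lattice,
  where the described extremal elements exist.\<close>

definition kappa :: "('a, 'c) gorder_scheme \<Rightarrow> 'a \<Rightarrow> 'a" where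
  "kappa L j = (THE k. greatest L k {y \<in> carrier L. j \<sqinter>\<^bsub>L\<^esub> y = lower_cover L j})"

definition kappa_dual :: "('a, 'c) gorder_scheme \<Rightarrow> 'a \<Rightarrow> 'a" where
  "kappa_dual L m = (THE k. least L k {x \<in> carrier L. m \<squnion>\<^bsub>L\<^esub> x = upper_cover L m})"

definition Ji_arrow :: "('a, 'c) gorder_scheme \<Rightarrow> 'a rel" where
  "Ji_arrow L = {(i, j). i \<in> Ji L \<and> j \<in> Ji L \<and> \<not> i \<sqsubseteq>\<^bsub>L\<^esub> kappa L j}"

definition Ji_onto :: "('a, 'c) gorder_scheme \<Rightarrow> 'a rel" where
  "Ji_onto L = {(i, j). i \<in> Ji L \<and> j \<in> Ji L \<and> j \<sqsubseteq>\<^bsub>L\<^esub> i}"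

definition Ji_into :: "('a, 'c) gorder_scheme \<Rightarrow> 'a rel" where
  "Ji_into L = {(i, j). i \<in> Ji L \<and> j \<in> Ji L \<and> kappa L j \<sqsubseteq>\<^bsub>L\<^esub> kappa L i}"

definition right_perp :: "'s set \<Rightarrow> 's rel \<Rightarrow> 's set \<Rightarrow> 's set" where
  "right_perp S r X = {y \<in> S. \<forall>x\<in>X. (x, y) \<notin> r}"

definition left_perp :: "'s set \<Rightarrow> 's rel \<Rightarrow> 's set \<Rightarrow> 's set" where
  "left_perp S r X = {y \<in> S. \<forall>x\<in>X. (y, x) \<notin> r}"

definition Pairs :: "'s set \<Rightarrow> 's rel \<Rightarrow> ('s set \<times> 's set) gorder" where
  "Pairs S r =
    \<lparr> carrier = {(X, Y). X \<subseteq> S \<and> Y \<subseteq> S \<and> Y = right_perp S r X \<and> X = left_perp S r Y},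
      eq = (=),
      le = (\<lambda>P Q. fst P \<subseteq> fst Q) \<rparr>"

definition Fact :: "'s set \<Rightarrow> 's rel \<Rightarrow> 's rel \<times> 's rel" where
  "Fact S r =
    ({(x, y). x \<in> S \<and> y \<in> S \<and> (\<forall>z\<in>S. (y, z) \<in> r \<longrightarrow> (x, z) \<in> r)},
     {(x, y). x \<in> S \<and> y \<in> S \<and> (\<forall>z\<in>S. (z, x) \<in> r \<longrightarrow> (z, y) \<in> r)})"

definition Mult :: "'s set \<Rightarrow> 's rel \<Rightarrow> 's rel \<Rightarrow> 's rel" where
  "Mult S onto into =
    {(x, z). x \<in> S \<and> z \<in> S \<and> (\<exists>y\<in>S. (x, y) \<in> onto \<and> (y, z) \<in> into)}"

definition factorization_system :: "'s set \<Rightarrow> 's rel \<Rightarrow> 's rel \<Rightarrow> 's rel \<Rightarrow> bool" where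
  "factorization_system S r onto into \<longleftrightarrow>
    r \<subseteq> S \<times> S \<and> refl_on S r \<and> Fact S r = (onto, into) \<and> Mult S onto into = r"

definition order_condition :: "'s rel \<Rightarrow> 's rel \<Rightarrow> bool" where
  "order_condition onto into \<longleftrightarrow>
    (\<forall>x y. (x, y) \<in> onto \<and> (y, x) \<in> onto \<longrightarrow> x = y) \<and>
    (\<forall>x y. (x, y) \<in> into \<and> (y, x) \<in> into \<longrightarrow> x = y)"

definition brick_condition :: "'s rel \<Rightarrow> 's rel \<Rightarrow> bool" where
  "brick_condition onto into \<longleftrightarrow> (\<forall>x y. (x, y) \<in> onto \<and> (y, x) \<in> into \<longrightarrow> x = y)"

definition two_acyclic_factorization_system ::
    "'s set \<Rightarrow> 's rel \<Rightarrow> 's rel \<Rightarrow> 's rel \<Rightarrow> bool" where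
  "two_acyclic_factorization_system S r onto into \<longleftrightarrow>
    factorization_system S r onto into \<and> order_condition onto into \<and> brick_condition onto into"

definition factorization_system_isomorphic ::
    "'s set \<Rightarrow> 's rel \<Rightarrow> 's rel \<Rightarrow> 's rel \<Rightarrow> 't set \<Rightarrow> 't rel \<Rightarrow> 't rel \<Rightarrow> 't rel \<Rightarrow> bool" where
  "factorization_system_isomorphic S r onto into S' r' onto' into' \<longleftrightarrow>
    (\<exists>f. bij_betw f S S' \<and>
      (\<forall>x\<in>S. \<forall>y\<in>S.
        ((x, y) \<in> r \<longleftrightarrow> (f x, f y) \<in> r') \<and>
        ((x, y) \<in> onto \<longleftrightarrow> (f x, f y) \<in> onto') \<and>
        ((x, y) \<in> into \<longleftrightarrow> (f x, f y) \<in> into')))"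

end

theory Submission
  imports Defs
begin

text \<open>
  In a finite semidistributive lattice, \<open>x \<sqsubseteq> y\<close> fails exactly if some join-irreducible \<open>j\<close> satisfies
  \<open>j \<sqsubseteq> x\<close> and \<open>y \<sqsubseteq> \<kappa>(j)\<close>: take \<open>j\<close> minimal among the elements below \<open>x\<close> and not below \<open>y\<close>, so that
  \<open>j\<^sub>* \<sqsubseteq> y\<close>. Maximal orthogonality of the pairs and the factorization of
  \<open>\<rightarrow>\<^sub>L\<close> are direct consequences.

  Conversely, in \<open>Pairs(\<rightarrow>)\<close> the closure of \<open>s\<close> is \<open>{t. s \<twoheadrightarrow> t}\<close>. By two-acyclicity
  it remains closed when \<open>s\<close> is removed, which makes it join-irreducible, and
  \<open>{t. \<not> t \<rightarrow> s}\<close> is the largest closed set \<open>X\<close> with \<open>s \<notin> X\<close> that contains all \<open>t \<noteq> s\<close> with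
  \<open>s \<twoheadrightarrow> t\<close>. The existence of such largest sets gives meet semidistributivity,
  and join semidistributivity is the same statement for the converse relations.
\<close>

section \<open>Covers in finite posets\<close>

locale finite_poset = partial_order +
  assumes finite_carrier: "finite (carrier L)"
begin

lemma dual_finite_poset: "finite_poset (inv_gorder L)"
  using dual_order finite_carrier by (simp add: finite_poset_def finite_poset_axioms_def)

lemma maximal_element_exists:
  assumes "A \<subseteq> carrier L" "A \<noteq> {}"
  obtains m where "m \<in> A" "\<And>x. x \<in> A \<Longrightarrow> m \<sqsubseteq> x \<Longrightarrow> x = m"
proof -
  let ?R = "\<lambda>x y. x \<sqsubseteq> y \<and> x \<noteq> y"
  have "finite A" using assms finite_carrier finite_subset by blast
  moreover have "asymp_on A ?R"
    using assms by (intro asymp_onI) (auto dest: le_antisym)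
  moreover have "transp_on A ?R"
  proof (rule transp_onI)
    fix x y z assume "x \<in> A" "y \<in> A" "z \<in> A" "?R x y" "?R y z"
    moreover from this assms(1) have "x \<in> carrier L" "y \<in> carrier L" "z \<in> carrier L" by blast+
    ultimately show "?R x z" using le_trans[of x y z] le_antisym[of x y] by blast
  qed
  ultimately obtain m where "m \<in> A" "\<forall>x\<in>A. x \<noteq> m \<longrightarrow> \<not> ?R m x"
    using Finite_Set.bex_max_element[of A ?R] assms(2) by blast
  then show ?thesis using that by metis
qed

lemma minimal_element_exists:
  assumes "A \<subseteq> carrier L" "A \<noteq> {}"
  obtains m where "m \<in> A" "\<And>x. x \<in> A \<Longrightarrow> x \<sqsubseteq> m \<Longrightarrow> x = m"
  using finite_poset.maximal_element_exists[OF dual_finite_poset, of A] assms by auto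

lemma covered_by_iff:
  "covered_by L x y \<longleftrightarrow> x \<in> carrier L \<and> y \<in> carrier L \<and> x \<sqsubseteq> y \<and> x \<noteq> y \<and>
    (\<forall>z\<in>carrier L. x \<sqsubseteq> z \<longrightarrow> z \<sqsubseteq> y \<longrightarrow> z = x \<or> z = y)"
  by (auto simp: covered_by_def lless_eq)

lemma greatest_unique_eq: "greatest L k X \<Longrightarrow> (THE k. greatest L k X) = k"
  by (rule the_equality) (auto intro: greatest_unique)

text \<open>Every lower cover of \<open>j\<close> lies below \<open>l\<close>, and nothing fits
  strictly between it and \<open>j\<close>, so it equals \<open>l\<close>. Applied in the inverse
  order, this also produces elements of \<open>Mi\<close>.\<close>

lemma JiI:
  assumes "j \<in> carrier L" "l \<in> carrier L" "l \<sqsubseteq> j" "l \<noteq> j"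
    and "\<And>x. x \<in> carrier L \<Longrightarrow> x \<sqsubseteq> j \<Longrightarrow> x \<noteq> j \<Longrightarrow> x \<sqsubseteq> l"
  shows "j \<in> Ji L" "lower_cover L j = l"
proof -
  have "covered_by L x j \<longleftrightarrow> x = l" for x
    using assms by (auto simp: covered_by_iff intro: le_antisym)
  then show "j \<in> Ji L" "lower_cover L j = l"
    using assms(1) by (auto simp: Ji_def lower_cover_def)
qed

lemma Ji_carrier: "j \<in> Ji L \<Longrightarrow> j \<in> carrier L"
  by (simp add: Ji_def)

lemma lower_cover_covered:
  assumes "j \<in> Ji L"
  shows "covered_by L (lower_cover L j) j"
  using assms unfolding Ji_def lower_cover_def by (auto intro: theI')

lemma lower_cover_carrier: "j \<in> Ji L \<Longrightarrow> lower_cover L j \<in> carrier L"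
  and lower_cover_le: "j \<in> Ji L \<Longrightarrow> lower_cover L j \<sqsubseteq> j"
  and lower_cover_neq: "j \<in> Ji L \<Longrightarrow> lower_cover L j \<noteq> j"
  using lower_cover_covered by (auto simp: covered_by_iff)

text \<open>Converse of \<open>JiI\<close>, where finiteness enters: a maximal element among those
  above \<open>x\<close> and strictly below \<open>j\<close> is covered by \<open>j\<close>, hence
  is its only lower cover.\<close>

lemma le_lower_cover:
  assumes j: "j \<in> Ji L" and x: "x \<in> carrier L" "x \<sqsubseteq> j" "x \<noteq> j"
  shows "x \<sqsubseteq> lower_cover L j"
proof -
  let ?A = "{z \<in> carrier L. x \<sqsubseteq> z \<and> z \<sqsubseteq> j \<and> z \<noteq> j}"
  have "?A \<subseteq> carrier L" "?A \<noteq> {}" using x by auto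
  then obtain m where m: "m \<in> ?A" "\<And>y. y \<in> ?A \<Longrightarrow> m \<sqsubseteq> y \<Longrightarrow> y = m"
    by (rule maximal_element_exists) blast
  have "z = m \<or> z = j" if "z \<in> carrier L" "m \<sqsubseteq> z" "z \<sqsubseteq> j" for z
  proof -
    have "x \<sqsubseteq> z" using m(1) that x(1) by (auto intro: le_trans[of x m z])
    then show ?thesis using m(2)[of z] that by blast
  qed
  then have "covered_by L m j"
    using m(1) Ji_carrier[OF j] by (auto simp: covered_by_iff)
  then have "m = lower_cover L j"
    using j lower_cover_covered[OF j] by (auto simp: Ji_def)
  then show ?thesis using m(1) by simp
qed

section \<open>Passage to the inverse order\<close>

lemma covered_by_dual: "covered_by (inv_gorder L) x y = covered_by L y x"
proof -
  interpret d: finite_poset "inv_gorder L" by (rule dual_finite_poset)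
  show ?thesis unfolding d.covered_by_iff covered_by_iff by auto
qed

lemma Ji_dual: "Ji (inv_gorder L) = Mi L"
  and Mi_dual: "Mi (inv_gorder L) = Ji L"
  and lower_cover_dual: "lower_cover (inv_gorder L) = upper_cover L"
  and upper_cover_dual: "upper_cover (inv_gorder L) = lower_cover L"
  by (auto simp: Ji_def Mi_def lower_cover_def upper_cover_def covered_by_dual fun_eq_iff)

lemma kappa_inv_gorder: "kappa (inv_gorder L) = kappa_dual L"
  and kappa_dual_inv_gorder: "kappa_dual (inv_gorder L) = kappa L"
  by (auto simp: kappa_def kappa_dual_def lower_cover_dual upper_cover_dual fun_eq_iff)

end

section \<open>Finite semidistributive lattices\<close>

locale finite_semidistributive_lattice = lattice + finite_poset +
  assumes carrier_nonempty: "carrier L \<noteq> {}"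
    and join_semidistributive: "join_semidistributive L"
    and meet_semidistributive: "meet_semidistributive L"
begin

lemma dual_finite_semidistributive_lattice: "finite_semidistributive_lattice (inv_gorder L)"
proof -
  interpret d: lattice "inv_gorder L" by (rule dual_lattice)
  show ?thesis
    using join_semidistributive meet_semidistributive finite_carrier carrier_nonempty
    by unfold_locales (auto simp: join_semidistributive_def meet_semidistributive_def)
qed

text \<open>Turns the equation in the definition of \<open>kappa\<close> into two order conditions,
  the form that \<open>le_kappa\<close> needs.\<close>

lemma meet_eq_lower_cover_iff:
  assumes "j \<in> Ji L" "y \<in> carrier L"
  shows "j \<sqinter> y = lower_cover L j \<longleftrightarrow> lower_cover L j \<sqsubseteq> y \<and> \<not> j \<sqsubseteq> y"
proof
  assume eq: "j \<sqinter> y = lower_cover L j"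
  then show "lower_cover L j \<sqsubseteq> y \<and> \<not> j \<sqsubseteq> y"
    using assms by (metis Ji_carrier le_iff_join lower_cover_neq meet_right)
next
  assume *: "lower_cover L j \<sqsubseteq> y \<and> \<not> j \<sqsubseteq> y"
  have c: "j \<in> carrier L" "lower_cover L j \<in> carrier L"
    using assms by (auto intro: Ji_carrier lower_cover_carrier)
  have "lower_cover L j \<sqsubseteq> j \<sqinter> y"
    using * assms c by (auto intro: meet_le lower_cover_le)
  moreover have "j \<sqinter> y \<noteq> j" using * assms c meet_right[of j y] by auto
  then have "j \<sqinter> y \<sqsubseteq> lower_cover L j"
    using assms c by (simp add: le_lower_cover meet_left)
  ultimately show "j \<sqinter> y = lower_cover L j"
    using assms c by (auto intro: le_antisym)
qed

text \<open>Finiteness gives a maximal member \<open>k\<close> of the set. For any member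
  \<open>y\<close>, meet semidistributivity keeps \<open>k \<squnion> y\<close> in the set, so
  \<open>k\<close> absorbs \<open>y\<close>.\<close>

lemma kappa_greatest:
  assumes j: "j \<in> Ji L"
  shows "greatest L (kappa L j) {y \<in> carrier L. j \<sqinter> y = lower_cover L j}"
proof -
  let ?A = "{y \<in> carrier L. j \<sqinter> y = lower_cover L j}"
  have c: "j \<in> carrier L" "lower_cover L j \<in> carrier L"
    using j by (auto intro: Ji_carrier lower_cover_carrier)
  have "\<not> j \<sqsubseteq> lower_cover L j"
    using j c by (metis le_antisym lower_cover_le lower_cover_neq)
  then have "lower_cover L j \<in> ?A"
    using j c by (simp add: meet_eq_lower_cover_iff)
  then have "?A \<noteq> {}" by blast
  moreover have "?A \<subseteq> carrier L" by blast
  ultimately obtain k where k: "k \<in> ?A" "\<And>y. y \<in> ?A \<Longrightarrow> k \<sqsubseteq> y \<Longrightarrow> y = k"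
    by (metis (no_types, lifting) maximal_element_exists)
  have "y \<sqsubseteq> k" if y: "y \<in> ?A" for y
  proof -
    have "j \<sqinter> (k \<squnion> y) = j \<sqinter> k"
      using meet_semidistributive y k(1) c unfolding meet_semidistributive_def by simp
    then have "k \<squnion> y \<in> ?A" using y k(1) by auto
    then have "k \<squnion> y = k" using k join_left[of k y] y by auto
    then show ?thesis using join_right[of k y] y k(1) by auto
  qed
  then have "greatest L k ?A" using k(1) by (auto simp: greatest_def)
  moreover have "kappa L j = k"
    unfolding kappa_def by (rule greatest_unique_eq) (fact calculation)
  ultimately show ?thesis by simp
qed

lemma kappa_carrier: "j \<in> Ji L \<Longrightarrow> kappa L j \<in> carrier L"
  by (rule greatest_closed[OF kappa_greatest])

lemma not_le_kappa: "j \<in> Ji L \<Longrightarrow> \<not> j \<sqsubseteq> kappa L j"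
  and lower_cover_le_kappa: "j \<in> Ji L \<Longrightarrow> lower_cover L j \<sqsubseteq> kappa L j"
proof -
  assume j: "j \<in> Ji L"
  have "j \<sqinter> kappa L j = lower_cover L j" using greatest_mem[OF kappa_greatest[OF j]] by simp
  then show "\<not> j \<sqsubseteq> kappa L j" "lower_cover L j \<sqsubseteq> kappa L j"
    using meet_eq_lower_cover_iff[OF j kappa_carrier[OF j]] by simp_all
qed

lemma le_kappa:
  assumes "j \<in> Ji L" "y \<in> carrier L" "lower_cover L j \<sqsubseteq> y" "\<not> j \<sqsubseteq> y"
  shows "y \<sqsubseteq> kappa L j"
  using assms by (intro greatest_le[OF kappa_greatest]) (simp_all add: meet_eq_lower_cover_iff)

text \<open>From right to left, \<open>x \<sqsubseteq> y\<close> would put \<open>j\<close> below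
  \<open>kappa L j\<close>. Instances of this separation yield the factorization of the arrow, the
  embedding into \<open>Pairs\<close> and the representation of elements as joins.\<close>

lemma not_le_iff:
  assumes "x \<in> carrier L" "y \<in> carrier L"
  shows "\<not> x \<sqsubseteq> y \<longleftrightarrow> (\<exists>j\<in>Ji L. j \<sqsubseteq> x \<and> y \<sqsubseteq> kappa L j)"
proof
  assume "\<not> x \<sqsubseteq> y"
  let ?A = "{z \<in> carrier L. z \<sqsubseteq> x \<and> \<not> z \<sqsubseteq> y}"
  have "?A \<subseteq> carrier L" "?A \<noteq> {}" using \<open>\<not> x \<sqsubseteq> y\<close> assms by auto
  then obtain j where j: "j \<in> ?A" "\<And>z. z \<in> ?A \<Longrightarrow> z \<sqsubseteq> j \<Longrightarrow> z = j"
    by (rule minimal_element_exists) blast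
  have below: "z \<sqsubseteq> y" if "z \<in> carrier L" "z \<sqsubseteq> j" "z \<noteq> j" for z
    using j that assms le_trans[of z j x] by blast
  \<comment> \<open>By \<open>below\<close>, everything strictly under \<open>j\<close> is under
    \<open>j \<sqinter> y\<close>, which therefore becomes the lower cover.\<close>
  have ne: "j \<sqinter> y \<noteq> j" using j(1) assms by (auto simp: le_iff_join)
  have "z \<sqsubseteq> j \<sqinter> y" if "z \<in> carrier L" "z \<sqsubseteq> j" "z \<noteq> j" for z
    using below[OF that] that j(1) assms by (auto intro: meet_le)
  then have "j \<in> Ji L" "lower_cover L j = j \<sqinter> y"
    using JiI[of j "j \<sqinter> y"] ne j(1) assms by (auto simp: meet_left)
  moreover have "y \<sqsubseteq> kappa L j"
    using calculation j(1) assms by (auto intro!: le_kappa simp: meet_right)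
  ultimately show "\<exists>j\<in>Ji L. j \<sqsubseteq> x \<and> y \<sqsubseteq> kappa L j" using j(1) by blast
next
  assume "\<exists>j\<in>Ji L. j \<sqsubseteq> x \<and> y \<sqsubseteq> kappa L j"
  then show "\<not> x \<sqsubseteq> y"
    using assms by (meson Ji_carrier kappa_carrier le_trans not_le_kappa)
qed

text \<open>An \<open>x\<close> strictly above \<open>kappa L j\<close> is above the lower cover of
  \<open>j\<close>; if it were not above \<open>j\<close>, then \<open>le_kappa\<close> would push
  it back below \<open>kappa L j\<close>. So \<open>kappa L j \<squnion> j\<close> is the least
  element strictly above, and the dual of \<open>JiI\<close> applies.\<close>

lemma Mi_kappa:
  assumes j: "j \<in> Ji L"
  shows "kappa L j \<in> Mi L" "upper_cover L (kappa L j) = kappa L j \<squnion> j"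
proof -
  interpret d: finite_poset "inv_gorder L" by (rule dual_finite_poset)
  have c: "j \<in> carrier L" "kappa L j \<in> carrier L" "lower_cover L j \<in> carrier L"
    using j by (auto intro: Ji_carrier kappa_carrier lower_cover_carrier)
  have "kappa L j \<squnion> j \<sqsubseteq> x" if x: "x \<in> carrier L" "kappa L j \<sqsubseteq> x" "x \<noteq> kappa L j" for x
  proof (rule ccontr)
    assume "\<not> kappa L j \<squnion> j \<sqsubseteq> x"
    then have "\<not> j \<sqsubseteq> x" using x c by (auto intro: join_le)
    moreover have "lower_cover L j \<sqsubseteq> x"
      using lower_cover_le_kappa[OF j] x c le_trans by blast
    ultimately have "x \<sqsubseteq> kappa L j" using j x by (simp add: le_kappa)
    then show False using x c by (auto dest: le_antisym)
  qed
  moreover have "kappa L j \<squnion> j \<noteq> kappa L j"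
    using not_le_kappa[OF j] join_right[of "kappa L j" j] c by auto
  ultimately show "kappa L j \<in> Mi L" "upper_cover L (kappa L j) = kappa L j \<squnion> j"
    using d.JiI[of "kappa L j" "kappa L j \<squnion> j"] c
    by (auto simp: Ji_dual lower_cover_dual join_left)
qed

text \<open>The element \<open>?i\<close> is at most \<open>j\<close> by minimality and is not below
  \<open>?m\<close>. Strictly below \<open>j\<close> it would lie below the lower cover of
  \<open>j\<close>, hence below \<open>?m\<close>.\<close>

lemma kappa_dual_kappa:
  assumes j: "j \<in> Ji L"
  shows "kappa_dual L (kappa L j) = j"
proof -
  interpret d: finite_semidistributive_lattice "inv_gorder L"
    by (rule dual_finite_semidistributive_lattice)
  let ?m = "kappa L j"
  let ?i = "kappa_dual L ?m"
  have m: "?m \<in> Mi L" and up: "upper_cover L ?m = ?m \<squnion> j" using Mi_kappa j by auto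
  have c: "j \<in> carrier L" "?m \<in> carrier L" "?i \<in> carrier L"
    using j m d.kappa_carrier[of ?m] by (auto intro: Ji_carrier kappa_carrier simp: Ji_dual kappa_inv_gorder)
  have least: "least L ?i {x \<in> carrier L. ?m \<squnion> x = upper_cover L ?m}"
    using d.kappa_greatest[of ?m] m by (simp add: Ji_dual kappa_inv_gorder lower_cover_dual)
  have "?i \<sqsubseteq> j" using least_le[OF least] c up by auto
  moreover have "\<not> ?i \<sqsubseteq> ?m"
    using d.not_le_kappa[of ?m] m by (simp add: Ji_dual kappa_inv_gorder)
  ultimately show ?thesis
    using le_lower_cover[OF j, of ?i] lower_cover_le_kappa[OF j] lower_cover_carrier[OF j] c le_trans
    by blast
qed

end

section \<open>Inverse bijections and the factorization system on \<open>Ji L\<close>\<close>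

context finite_semidistributive_lattice
begin

lemma Ji_kappa_dual: "m \<in> Mi L \<Longrightarrow> kappa_dual L m \<in> Ji L"
  and kappa_kappa_dual: "m \<in> Mi L \<Longrightarrow> kappa L (kappa_dual L m) = m"
proof -
  interpret d: finite_semidistributive_lattice "inv_gorder L"
    by (rule dual_finite_semidistributive_lattice)
  show "m \<in> Mi L \<Longrightarrow> kappa_dual L m \<in> Ji L" "m \<in> Mi L \<Longrightarrow> kappa L (kappa_dual L m) = m"
    using d.Mi_kappa(1)[of m] d.kappa_dual_kappa[of m]
    by (simp_all add: Ji_dual Mi_dual kappa_inv_gorder kappa_dual_inv_gorder)
qed

text \<open>Rewrites the second component of the map in the theorem in terms of
  \<open>kappa\<close>, which is how the perps are computed.\<close>

lemma kappa_dual_image: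
  assumes "x \<in> carrier L"
  shows "kappa_dual L ` {m \<in> Mi L. x \<sqsubseteq> m} = {j \<in> Ji L. x \<sqsubseteq> kappa L j}"
proof (intro equalityI subsetI)
  fix j assume "j \<in> {j \<in> Ji L. x \<sqsubseteq> kappa L j}"
  then show "j \<in> kappa_dual L ` {m \<in> Mi L. x \<sqsubseteq> m}"
    using Mi_kappa(1)[of j] by (intro image_eqI[of _ _ "kappa L j"]) (auto simp: kappa_dual_kappa)
qed (auto simp: Ji_kappa_dual kappa_kappa_dual)

text \<open>If the order relation fails, the join-irreducible supplied by \<open>not_le_iff\<close>
  is a test element \<open>k\<close> that violates the quantified condition. The other directions
  are transitivity.\<close>

lemma Fact_Ji_arrow: "Fact (Ji L) (Ji_arrow L) = (Ji_onto L, Ji_into L)"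
proof -
  have onto: "(\<forall>k\<in>Ji L. \<not> j \<sqsubseteq> kappa L k \<longrightarrow> \<not> i \<sqsubseteq> kappa L k) \<longleftrightarrow> j \<sqsubseteq> i"
    if "i \<in> Ji L" "j \<in> Ji L" for i j
    using that not_le_iff[of j i] by (meson Ji_carrier kappa_carrier le_trans not_le_kappa)
  have into: "(\<forall>k\<in>Ji L. \<not> k \<sqsubseteq> kappa L i \<longrightarrow> \<not> k \<sqsubseteq> kappa L j) \<longleftrightarrow> kappa L j \<sqsubseteq> kappa L i"
    if "i \<in> Ji L" "j \<in> Ji L" for i j
    using that not_le_iff[of "kappa L j" "kappa L i"]
    by (meson Ji_carrier kappa_carrier le_trans not_le_kappa)
  have "Fact (Ji L) (Ji_arrow L) =
      ({(i, j). i \<in> Ji L \<and> j \<in> Ji L \<and> (\<forall>k\<in>Ji L. \<not> j \<sqsubseteq> kappa L k \<longrightarrow> \<not> i \<sqsubseteq> kappa L k)},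
       {(i, j). i \<in> Ji L \<and> j \<in> Ji L \<and> (\<forall>k\<in>Ji L. \<not> k \<sqsubseteq> kappa L i \<longrightarrow> \<not> k \<sqsubseteq> kappa L j)})"
    by (auto simp: Fact_def Ji_arrow_def)
  also have "\<dots> = (Ji_onto L, Ji_into L)"
    unfolding Ji_onto_def Ji_into_def by (simp add: onto into cong: conj_cong)
  finally show ?thesis .
qed

text \<open>This is \<open>not_le_iff\<close> for \<open>i\<close> and \<open>kappa L j\<close>: the
  separating join-irreducible is the middle element of the factorization.\<close>

lemma Mult_Ji: "Mult (Ji L) (Ji_onto L) (Ji_into L) = Ji_arrow L"
  using not_le_iff[OF Ji_carrier kappa_carrier]
  by (auto simp: Mult_def Ji_arrow_def Ji_onto_def Ji_into_def)

lemma two_acyclic_factorization_system_Ji: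
  "two_acyclic_factorization_system (Ji L) (Ji_arrow L) (Ji_onto L) (Ji_into L)"
proof -
  \<comment> \<open>Here \<open>kappa\<close> is injective because \<open>kappa_dual\<close> undoes
    it.\<close>
  have "i = j" if "i \<in> Ji L" "j \<in> Ji L" "kappa L i \<sqsubseteq> kappa L j" "kappa L j \<sqsubseteq> kappa L i" for i j
    using that kappa_carrier kappa_dual_kappa le_antisym by metis
  then have "order_condition (Ji_onto L) (Ji_into L)"
    by (auto simp: order_condition_def Ji_onto_def Ji_into_def intro: Ji_carrier le_antisym)
  moreover have "i = j" if "i \<in> Ji L" "j \<in> Ji L" "j \<sqsubseteq> i" "kappa L i \<sqsubseteq> kappa L j" for i j
  proof (rule ccontr)
    assume "i \<noteq> j"
    \<comment> \<open>The chain from \<open>j\<close> through the lower cover of \<open>i\<close>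
      and \<open>kappa L i\<close> up to \<open>kappa L j\<close> contradicts
      \<open>not_le_kappa\<close>.\<close>
    then have "j \<sqsubseteq> lower_cover L i" using that Ji_carrier by (intro le_lower_cover) auto
    then have "j \<sqsubseteq> kappa L i"
      using that by (meson Ji_carrier kappa_carrier le_trans lower_cover_carrier lower_cover_le_kappa)
    then show False using that by (meson Ji_carrier kappa_carrier le_trans not_le_kappa)
  qed
  then have "brick_condition (Ji_onto L) (Ji_into L)"
    by (auto simp: brick_condition_def Ji_onto_def Ji_into_def)
  moreover have "refl_on (Ji L) (Ji_arrow L)" "Ji_arrow L \<subseteq> Ji L \<times> Ji L"
    by (auto simp: refl_on_def Ji_arrow_def not_le_kappa)
  ultimately show ?thesis
    by (simp add: two_acyclic_factorization_system_def factorization_system_def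
        Fact_Ji_arrow Mult_Ji)
qed

text \<open>If \<open>x\<close> is not below \<open>kappa L j\<close>, then
  \<open>not_le_iff\<close> gives a join-irreducible below \<open>x\<close> that has an arrow to
  \<open>j\<close>.\<close>

lemma right_perp_Ji_below:
  assumes "x \<in> carrier L"
  shows "right_perp (Ji L) (Ji_arrow L) {j \<in> Ji L. j \<sqsubseteq> x} = {j \<in> Ji L. x \<sqsubseteq> kappa L j}"
  using assms not_le_iff[OF assms kappa_carrier]
  by (auto simp: right_perp_def Ji_arrow_def) (meson Ji_carrier kappa_carrier le_trans not_le_kappa)+

lemma left_perp_kappa_above:
  assumes "x \<in> carrier L"
  shows "left_perp (Ji L) (Ji_arrow L) {j \<in> Ji L. x \<sqsubseteq> kappa L j} = {j \<in> Ji L. j \<sqsubseteq> x}"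
  using assms not_le_iff[OF Ji_carrier assms]
  by (auto simp: left_perp_def Ji_arrow_def) (meson Ji_carrier kappa_carrier le_trans not_le_kappa)+

lemma sup_least:
  assumes "X \<subseteq> carrier L"
  shows "least L (\<Squnion>X) (Upper L X)"
proof (cases "X = {}")
  case True
  \<comment> \<open>Every element bounds the empty set, so its join is the bottom, obtained as the
    meet of the whole finite carrier.\<close>
  have "greatest L (\<Sqinter>(carrier L)) (Lower L (carrier L))"
    using finite_inf_greatest[OF finite_carrier _ carrier_nonempty] by simp
  then have "least L (\<Sqinter>(carrier L)) (Upper L X)"
    using True by (auto simp: least_def greatest_def Lower_def)
  then show ?thesis unfolding sup_def by (rule someI)
next
  case False
  then show ?thesis using assms finite_sup_least finite_carrier finite_subset by blast
qed

text \<open>An upper bound \<open>y\<close> not above \<open>x\<close> would be separated from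
  \<open>x\<close> by some \<open>j\<close> below \<open>x\<close> with \<open>y\<close> below
  \<open>kappa L j\<close>; but \<open>j\<close> is below \<open>y\<close>.\<close>

lemma sup_Ji_below:
  assumes "x \<in> carrier L"
  shows "\<Squnion>{j \<in> Ji L. j \<sqsubseteq> x} = x"
proof -
  have "x \<sqsubseteq> y" if y: "y \<in> Upper L {j \<in> Ji L. j \<sqsubseteq> x}" for y
  proof (rule ccontr)
    assume "\<not> x \<sqsubseteq> y"
    moreover have yc: "y \<in> carrier L" using y by (auto simp: Upper_def)
    ultimately obtain j where "j \<in> Ji L" "j \<sqsubseteq> x" "y \<sqsubseteq> kappa L j"
      using not_le_iff[OF assms yc] by blast
    moreover have "j \<sqsubseteq> y" using y calculation by (auto simp: Upper_def Ji_carrier)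
    ultimately show False using yc by (meson Ji_carrier kappa_carrier le_trans not_le_kappa)
  qed
  then have "least L x (Upper L {j \<in> Ji L. j \<sqsubseteq> x})"
    using assms by (auto simp: least_def Upper_def Ji_carrier)
  then show ?thesis
    using sup_least[of "{j \<in> Ji L. j \<sqsubseteq> x}"] least_unique by (auto intro: Ji_carrier)
qed

text \<open>Dual of \<open>sup_Ji_below\<close>, since \<open>kappa\<close> maps this index set onto
  the meet-irreducibles above \<open>x\<close>.\<close>

lemma inf_kappa_above:
  assumes "x \<in> carrier L"
  shows "\<Sqinter>(kappa L ` {j \<in> Ji L. x \<sqsubseteq> kappa L j}) = x"
proof -
  interpret d: finite_semidistributive_lattice "inv_gorder L"
    by (rule dual_finite_semidistributive_lattice)
  have "kappa L ` {j \<in> Ji L. x \<sqsubseteq> kappa L j} = {m \<in> Mi L. x \<sqsubseteq> m}"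
    unfolding kappa_dual_image[OF assms, symmetric] image_image
    by (force simp: kappa_kappa_dual)
  then show ?thesis using d.sup_Ji_below[of x] assms by (simp add: Ji_dual)
qed

text \<open>Supplies surjectivity and the inverse map. The form of \<open>Y\<close> is the universal
  property of the join; \<open>X\<close> is then determined as its left perp.\<close>

lemma perp_pair_sup:
  assumes "X \<subseteq> Ji L" "Y = right_perp (Ji L) (Ji_arrow L) X" "X = left_perp (Ji L) (Ji_arrow L) Y"
  shows "X = {j \<in> Ji L. j \<sqsubseteq> \<Squnion>X}" "Y = {j \<in> Ji L. \<Squnion>X \<sqsubseteq> kappa L j}"
proof -
  have X: "X \<subseteq> carrier L" using assms(1) by (auto intro: Ji_carrier)
  note lub = sup_least[OF X]
  have c: "\<Squnion>X \<in> carrier L" using lub by blast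
  have "\<Squnion>X \<sqsubseteq> kappa L j \<longleftrightarrow> (\<forall>i\<in>X. i \<sqsubseteq> kappa L j)" if "j \<in> Ji L" for j
  proof
    assume "\<Squnion>X \<sqsubseteq> kappa L j"
    then show "\<forall>i\<in>X. i \<sqsubseteq> kappa L j"
      using least_Upper_above[OF lub _ X] X c that by (meson kappa_carrier le_trans subsetD)
  qed (use that in \<open>auto intro!: least_le[OF lub] Upper_memI simp: kappa_carrier\<close>)
  then show Y: "Y = {j \<in> Ji L. \<Squnion>X \<sqsubseteq> kappa L j}"
    using assms(1) unfolding assms(2) by (simp add: right_perp_def Ji_arrow_def) blast
  have "X = left_perp (Ji L) (Ji_arrow L) Y" by fact
  also have "\<dots> = {j \<in> Ji L. j \<sqsubseteq> \<Squnion>X}" unfolding Y by (rule left_perp_kappa_above[OF c])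
  finally show "X = {j \<in> Ji L. j \<sqsubseteq> \<Squnion>X}" .
qed

end

section \<open>The isomorphism from \<open>L\<close> to \<open>Pairs\<close>\<close>

lemma mem_carrier_Pairs:
  "(X, Y) \<in> carrier (Pairs S r) \<longleftrightarrow>
    X \<subseteq> S \<and> Y \<subseteq> S \<and> Y = right_perp S r X \<and> X = left_perp S r Y"
  unfolding Pairs_def by simp

lemma weak_partial_order_Pairs: "weak_partial_order (Pairs S r)"
  by unfold_locales (auto simp: Pairs_def)

context finite_semidistributive_lattice
begin

lemma order_iso_Pairs:
  "order_iso L (Pairs (Ji L) (Ji_arrow L))
     (\<lambda>x. ({j \<in> Ji L. j \<sqsubseteq> x}, {j \<in> Ji L. x \<sqsubseteq> kappa L j}))"
    (is "order_iso L ?P ?f")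
proof -
  have "{j \<in> Ji L. j \<sqsubseteq> x} \<subseteq> {j \<in> Ji L. j \<sqsubseteq> y} \<longleftrightarrow> x \<sqsubseteq> y"
    if "x \<in> carrier L" "y \<in> carrier L" for x y
    using that not_le_iff[of x y]
    by (simp add: subset_iff) (meson Ji_carrier kappa_carrier le_trans not_le_kappa)
  then have emb: "order_emb L ?P ?f"
    unfolding order_emb_def
    by (simp add: weak_partial_order_Pairs weak_partial_order_axioms) (simp add: Pairs_def)
  have "inj_on ?f (carrier L)"
    by (rule inj_onI) (metis (no_types, lifting) fst_conv sup_Ji_below)
  moreover have "?f ` carrier L = carrier ?P"
  proof (intro equalityI subsetI)
    fix p assume p: "p \<in> carrier ?P"
    obtain X Y where XY: "p = (X, Y)" by (cases p)
    then have *: "X \<subseteq> Ji L" "Y = right_perp (Ji L) (Ji_arrow L) X"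
      "X = left_perp (Ji L) (Ji_arrow L) Y"
      using p unfolding XY mem_carrier_Pairs by blast+
    have "\<Squnion>X \<in> carrier L" using sup_least[of X] *(1) Ji_carrier by blast
    moreover have "p = ?f (\<Squnion>X)" using perp_pair_sup[OF *] XY by simp
    ultimately show "p \<in> ?f ` carrier L" by blast
  qed (auto simp: Pairs_def right_perp_Ji_below left_perp_kappa_above)
  ultimately show ?thesis using emb by (simp add: order_iso_def bij_betw_def)
qed

end

section \<open>Lattices of maximal orthogonal pairs\<close>

text \<open>An abstract \<open>L\<close> with component maps \<open>A\<close> and \<open>B\<close>
  stands for \<open>Pairs S r\<close>, so that the inverse order with \<open>A\<close> and
  \<open>B\<close> swapped is again an instance. Containment in \<open>S\<close> is implicit in
  \<open>pair_exists\<close>, as both perps are subsets of \<open>S\<close>.\<close>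

locale two_acyclic_pairs_lattice = finite_poset +
  fixes S :: "'s set" and r onto into and A B :: "'a \<Rightarrow> 's set"
  assumes finite_S: "finite S"
    and two_acyclic: "two_acyclic_factorization_system S r onto into"
    and le_iff: "x \<in> carrier L \<Longrightarrow> y \<in> carrier L \<Longrightarrow> x \<sqsubseteq> y \<longleftrightarrow> A x \<subseteq> A y"
    and B_eq: "x \<in> carrier L \<Longrightarrow> B x = right_perp S r (A x)"
    and A_eq: "x \<in> carrier L \<Longrightarrow> A x = left_perp S r (B x)"
    and pair_exists: "Y = right_perp S r X \<Longrightarrow> X = left_perp S r Y \<Longrightarrow>
      \<exists>x\<in>carrier L. A x = X \<and> B x = Y"
begin

lemma r_subset: "(s, t) \<in> r \<Longrightarrow> s \<in> S \<and> t \<in> S"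
  and r_refl: "s \<in> S \<Longrightarrow> (s, s) \<in> r"
  and onto_iff: "(s, t) \<in> onto \<longleftrightarrow> s \<in> S \<and> t \<in> S \<and> (\<forall>u\<in>S. (t, u) \<in> r \<longrightarrow> (s, u) \<in> r)"
  and into_iff: "(s, t) \<in> into \<longleftrightarrow> s \<in> S \<and> t \<in> S \<and> (\<forall>u\<in>S. (u, s) \<in> r \<longrightarrow> (u, t) \<in> r)"
  and r_iff: "(s, t) \<in> r \<longleftrightarrow> s \<in> S \<and> t \<in> S \<and> (\<exists>u\<in>S. (s, u) \<in> onto \<and> (u, t) \<in> into)"
  and onto_antisym: "(s, t) \<in> onto \<Longrightarrow> (t, s) \<in> onto \<Longrightarrow> s = t"
  and into_antisym: "(s, t) \<in> into \<Longrightarrow> (t, s) \<in> into \<Longrightarrow> s = t"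
  and brick: "(s, t) \<in> onto \<Longrightarrow> (t, s) \<in> into \<Longrightarrow> s = t"
proof -
  have *: "r \<subseteq> S \<times> S" "refl_on S r" "Fact S r = (onto, into)" "Mult S onto into = r"
    "order_condition onto into" "brick_condition onto into"
    using two_acyclic
    by (auto simp: two_acyclic_factorization_system_def factorization_system_def)
  show "(s, t) \<in> r \<Longrightarrow> s \<in> S \<and> t \<in> S" "s \<in> S \<Longrightarrow> (s, s) \<in> r"
    using *(1,2) by (auto simp: refl_on_def)
  show "(s, t) \<in> onto \<longleftrightarrow> s \<in> S \<and> t \<in> S \<and> (\<forall>u\<in>S. (t, u) \<in> r \<longrightarrow> (s, u) \<in> r)"
    "(s, t) \<in> into \<longleftrightarrow> s \<in> S \<and> t \<in> S \<and> (\<forall>u\<in>S. (u, s) \<in> r \<longrightarrow> (u, t) \<in> r)"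
    using *(3) by (auto simp: Fact_def)
  show "(s, t) \<in> r \<longleftrightarrow> s \<in> S \<and> t \<in> S \<and> (\<exists>u\<in>S. (s, u) \<in> onto \<and> (u, t) \<in> into)"
    by (subst *(4)[symmetric]) (simp add: Mult_def)
  show "(s, t) \<in> onto \<Longrightarrow> (t, s) \<in> onto \<Longrightarrow> s = t"
    "(s, t) \<in> into \<Longrightarrow> (t, s) \<in> into \<Longrightarrow> s = t"
    "(s, t) \<in> onto \<Longrightarrow> (t, s) \<in> into \<Longrightarrow> s = t"
    using *(5,6) unfolding order_condition_def brick_condition_def by blast+
qed

lemma onto_refl: "s \<in> S \<Longrightarrow> (s, s) \<in> onto"
  by (simp add: onto_iff)

lemma onto_trans: "(s, t) \<in> onto \<Longrightarrow> (t, u) \<in> onto \<Longrightarrow> (s, u) \<in> onto"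
  by (simp add: onto_iff)

text \<open>Taking converses swaps the two perps and reads each factorization backwards, so the
  roles of \<open>onto\<close> and \<open>into\<close> are exchanged.\<close>

lemma dual_two_acyclic_pairs_lattice:
  "two_acyclic_pairs_lattice (inv_gorder L) S (r\<inverse>) (into\<inverse>) (onto\<inverse>) B A"
proof -
  interpret d: finite_poset "inv_gorder L" by (rule dual_finite_poset)
  have perps: "right_perp S (r\<inverse>) = left_perp S r" "left_perp S (r\<inverse>) = right_perp S r"
    by (auto simp: right_perp_def left_perp_def fun_eq_iff)
  have "Fact S (r\<inverse>) = (into\<inverse>, onto\<inverse>)"
    by (auto simp: Fact_def onto_iff into_iff)
  moreover have "Mult S (into\<inverse>) (onto\<inverse>) = r\<inverse>"
    by (auto simp: Mult_def r_iff)
  ultimately have "two_acyclic_factorization_system S (r\<inverse>) (into\<inverse>) (onto\<inverse>)"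
    using r_subset r_refl onto_antisym into_antisym brick
    by (auto simp: two_acyclic_factorization_system_def factorization_system_def
        order_condition_def brick_condition_def refl_on_def)
  moreover have "y \<sqsubseteq> x \<longleftrightarrow> B x \<subseteq> B y" if "x \<in> carrier L" "y \<in> carrier L" for x y
  proof
    assume "y \<sqsubseteq> x"
    then show "B x \<subseteq> B y" using that by (auto simp: le_iff B_eq right_perp_def)
  next
    assume "B x \<subseteq> B y"
    then have "left_perp S r (B y) \<subseteq> left_perp S r (B x)" by (auto simp: left_perp_def)
    then show "y \<sqsubseteq> x" using that by (simp add: le_iff flip: A_eq)
  qed
  moreover have "\<exists>x\<in>carrier L. B x = X \<and> A x = Y"
    if "Y = left_perp S r X" "X = right_perp S r Y" for X Y
    using pair_exists[OF that(2,1)] by blast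
  ultimately show ?thesis
    using finite_S by unfold_locales (simp_all add: perps flip: A_eq B_eq)
qed

lemma mem_A: "x \<in> carrier L \<Longrightarrow> t \<in> A x \<longleftrightarrow> t \<in> S \<and> (\<forall>b\<in>B x. (t, b) \<notin> r)"
  by (subst A_eq) (auto simp: left_perp_def)

lemma A_subset: "x \<in> carrier L \<Longrightarrow> A x \<subseteq> S"
  by (auto simp: mem_A)

lemma B_subset: "x \<in> carrier L \<Longrightarrow> B x \<subseteq> S"
  by (simp add: B_eq right_perp_def)

text \<open>Applying the perps three times gives the same set as applying one, so
  \<open>left_perp S r Y\<close> and its right perp form a maximal orthogonal pair.\<close>

lemma left_perp_closed: "\<exists>x\<in>carrier L. A x = left_perp S r Y" if "Y \<subseteq> S"
proof -
  have "left_perp S r Y = left_perp S r (right_perp S r (left_perp S r Y))"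
    using that by (auto simp: left_perp_def right_perp_def)
  then show ?thesis using pair_exists by blast
qed

lemma A_onto:
  assumes "x \<in> carrier L" "s \<in> A x" "(s, t) \<in> onto"
  shows "t \<in> A x"
  using assms B_subset[of x] by (auto simp: mem_A onto_iff)

lemma inter_closed:
  assumes "x \<in> carrier L" "y \<in> carrier L"
  shows "\<exists>z\<in>carrier L. A z = A x \<inter> A y"
proof -
  have "A x \<inter> A y = left_perp S r (B x \<union> B y)"
    using assms by (auto simp: mem_A left_perp_def)
  moreover have "B x \<union> B y \<subseteq> S"
    using assms by (simp add: B_subset)
  ultimately show ?thesis using left_perp_closed by metis
qed

lemma greatest_inter:
  assumes "x \<in> carrier L" "y \<in> carrier L" "z \<in> carrier L" "A z = A x \<inter> A y"
  shows "greatest L z (Lower L {x, y})"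
proof (rule greatest_LowerI)
  fix v assume "v \<in> Lower L {x, y}"
  then have "v \<in> carrier L" "v \<sqsubseteq> x" "v \<sqsubseteq> y" using assms by (simp_all add: Lower_def)
  then show "v \<sqsubseteq> z" using assms by (simp add: le_iff)
next
  fix v assume "v \<in> {x, y}"
  then show "z \<sqsubseteq> v" using assms(1-3) by (elim insertE emptyE) (simp_all add: le_iff assms(4))
qed (use assms in simp_all)

end

section \<open>Lattice structure and irreducible elements of \<open>Pairs\<close>\<close>

context two_acyclic_pairs_lattice
begin

lemma is_lattice: "lattice L"
proof -
  interpret d: two_acyclic_pairs_lattice "inv_gorder L" S "r\<inverse>" "into\<inverse>" "onto\<inverse>" B A
    by (rule dual_two_acyclic_pairs_lattice)
  show ?thesis
  proof
    fix x y assume "x \<in> carrier L" "y \<in> carrier L"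
    \<comment> \<open>Joins are the meets of the dual instance, where second components are
      intersected.\<close>
    then show "\<exists>s. least L s (Upper L {x, y})" "\<exists>s. greatest L s (Lower L {x, y})"
      using d.inter_closed[of x y] d.greatest_inter[of x y] inter_closed[of x y]
        greatest_inter[of x y]
      by auto
  qed
qed

sublocale lattice
  by (rule is_lattice)

lemma A_meet:
  assumes "x \<in> carrier L" "y \<in> carrier L"
  shows "A (x \<sqinter> y) = A x \<inter> A y"
proof -
  obtain z where z: "z \<in> carrier L" "A z = A x \<inter> A y"
    using inter_closed assms by blast
  then have "greatest L z (Lower L {x, y})" using greatest_inter assms by simp
  then have "x \<sqinter> y = z" using greatest_unique inf_of_two_greatest assms unfolding meet_def by blast
  then show ?thesis using z by simp
qed

text \<open>The first component is the closure of \<open>{s}\<close>, that is, the left perp of its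
  right perp.\<close>

definition ji :: "'s \<Rightarrow> 'a" where
  "ji s = (SOME x. x \<in> carrier L \<and> A x = {t. (s, t) \<in> onto})"

text \<open>The first component is \<open>left_perp S r {s}\<close>; \<open>kappa_ji\<close> will
  identify the element as the image of \<open>ji s\<close> under \<open>kappa\<close>.\<close>

definition mi :: "'s \<Rightarrow> 'a" where
  "mi s = (SOME x. x \<in> carrier L \<and> A x = {t \<in> S. (t, s) \<notin> r})"

lemma ji_carrier: "s \<in> S \<Longrightarrow> ji s \<in> carrier L"
  and A_ji: "s \<in> S \<Longrightarrow> A (ji s) = {t. (s, t) \<in> onto}"
proof -
  assume "s \<in> S"
  then have "left_perp S r (right_perp S r {s}) = {t. (s, t) \<in> onto}"
    by (auto simp: left_perp_def right_perp_def onto_iff)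
  then have "\<exists>x. x \<in> carrier L \<and> A x = {t. (s, t) \<in> onto}"
    using left_perp_closed[of "right_perp S r {s}"] by (auto simp: right_perp_def)
  from someI_ex[OF this] show "ji s \<in> carrier L" "A (ji s) = {t. (s, t) \<in> onto}"
    by (auto simp: ji_def)
qed

lemma mi_carrier: "s \<in> S \<Longrightarrow> mi s \<in> carrier L"
  and A_mi: "s \<in> S \<Longrightarrow> A (mi s) = {t \<in> S. (t, s) \<notin> r}"
proof -
  assume "s \<in> S"
  moreover have "left_perp S r {s} = {t \<in> S. (t, s) \<notin> r}"
    by (auto simp: left_perp_def)
  ultimately have "\<exists>x. x \<in> carrier L \<and> A x = {t \<in> S. (t, s) \<notin> r}"
    using left_perp_closed[of "{s}"] by auto
  from someI_ex[OF this] show "mi s \<in> carrier L" "A (mi s) = {t \<in> S. (t, s) \<notin> r}"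
    by (auto simp: mi_def)
qed

lemma ji_le_iff:
  assumes "s \<in> S" "x \<in> carrier L"
  shows "ji s \<sqsubseteq> x \<longleftrightarrow> s \<in> A x"
  using assms A_onto onto_refl by (auto simp: le_iff ji_carrier A_ji)

lemma mi_le_iff:
  assumes "s \<in> S" "t \<in> S"
  shows "mi s \<sqsubseteq> mi t \<longleftrightarrow> (t, s) \<in> into"
  using assms by (auto simp: le_iff mi_carrier A_mi into_iff)

text \<open>Two-acyclicity makes \<open>s\<close> the only member of its closure with an arrow to
  \<open>s\<close>: factoring such an arrow from \<open>t\<close> through \<open>u\<close>, the
  brick condition gives \<open>u = s\<close>, and then the order condition gives
  \<open>t = s\<close>.\<close>

lemma A_ji_inter_mi:
  assumes s: "s \<in> S"
  shows "A (ji s) \<inter> A (mi s) = A (ji s) - {s}"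
proof -
  have "t = s" if st: "(s, t) \<in> onto" and ts: "(t, s) \<in> r" for t
  proof -
    obtain u where u: "(t, u) \<in> onto" "(u, s) \<in> into" using ts r_iff by blast
    then have "s = u" using st brick onto_trans by blast
    then show ?thesis using u st onto_antisym by blast
  qed
  then show ?thesis using s r_refl by (auto simp: A_ji A_mi onto_iff)
qed

text \<open>Some arrow from \<open>s\<close> to \<open>b\<close> witnesses that \<open>s\<close> is
  outside \<open>A y\<close>. Its middle element \<open>u\<close> also has an arrow to
  \<open>b\<close>, so \<open>sub\<close> forces \<open>u = s\<close>. Then every arrow into
  \<open>s\<close> extends to \<open>b\<close>, so none starts in \<open>A y\<close>.\<close>

lemma le_mi:
  assumes s: "s \<in> S" and y: "y \<in> carrier L" and "s \<notin> A y" and sub: "A (ji s) - {s} \<subseteq> A y"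
  shows "y \<sqsubseteq> mi s"
proof -
  note yA = mem_A[OF y]
  obtain b where b: "b \<in> B y" "(s, b) \<in> r" using s assms(3) yA by blast
  then obtain u where u: "(s, u) \<in> onto" "(u, b) \<in> into" using r_iff by blast
  have "(u, b) \<in> r" using u(2) into_iff r_refl by blast
  then have "u \<notin> A y" using b(1) yA by blast
  then have "u = s" using sub u(1) s by (auto simp: A_ji)
  with u have sb: "(s, b) \<in> into" by simp
  have "(t, s) \<notin> r" if t: "t \<in> A y" for t
  proof
    assume "(t, s) \<in> r"
    then have "(t, b) \<in> r" using sb r_subset unfolding into_iff by blast
    then show False using t b(1) yA by blast
  qed
  then show ?thesis using s y A_subset[OF y] by (auto simp: le_iff mi_carrier A_mi)
qed

text \<open>The set \<open>A (ji s) - {s}\<close> is the first component of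
  \<open>ji s \<sqinter> mi s\<close>. An element below \<open>ji s\<close> either contains
  \<open>s\<close>, and then equals \<open>ji s\<close>, or lies below this meet.\<close>

lemma Ji_ji:
  assumes s: "s \<in> S"
  shows "ji s \<in> Ji L" "lower_cover L (ji s) = ji s \<sqinter> mi s"
proof -
  have c: "ji s \<in> carrier L" "mi s \<in> carrier L" using s by (auto simp: ji_carrier mi_carrier)
  have A: "A (ji s \<sqinter> mi s) = A (ji s) - {s}" using c A_ji_inter_mi[OF s] by (simp add: A_meet)
  have "ji s \<sqinter> mi s \<noteq> ji s"
  proof
    assume "ji s \<sqinter> mi s = ji s"
    then show False using A s onto_refl[OF s] by (auto simp: A_ji)
  qed
  moreover have "x \<sqsubseteq> ji s \<sqinter> mi s" if x: "x \<in> carrier L" "x \<sqsubseteq> ji s" "x \<noteq> ji s" for x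
  proof -
    have "s \<notin> A x" using x s c ji_le_iff le_antisym by blast
    then show ?thesis using x c A by (auto simp: le_iff)
  qed
  ultimately show "ji s \<in> Ji L" "lower_cover L (ji s) = ji s \<sqinter> mi s"
    using JiI[of "ji s" "ji s \<sqinter> mi s"] c meet_left by auto
qed

lemma kappa_ji:
  assumes s: "s \<in> S"
  shows "kappa L (ji s) = mi s"
proof -
  have c: "ji s \<in> carrier L" "mi s \<in> carrier L" using s by (auto simp: ji_carrier mi_carrier)
  have "y \<sqsubseteq> mi s" if y: "y \<in> carrier L" "ji s \<sqinter> y = ji s \<sqinter> mi s" for y
  proof -
    have "A (ji s) \<inter> A y = A (ji s) - {s}"
      using A_meet[of "ji s" y] A_meet[of "ji s" "mi s"] y c A_ji_inter_mi[OF s] by simp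
    moreover have "s \<in> A (ji s)" using s onto_refl by (simp add: A_ji)
    ultimately show ?thesis using le_mi[OF s y(1)] by blast
  qed
  then have "greatest L (mi s) {y \<in> carrier L. ji s \<sqinter> y = lower_cover L (ji s)}"
    using c by (auto simp: greatest_def Ji_ji[OF s])
  then show ?thesis unfolding kappa_def by (rule greatest_unique_eq)
qed

text \<open>Choose \<open>s\<close> in \<open>A j\<close> but not in the first component of the
  lower cover: \<open>ji s\<close> is below \<open>j\<close> but not below the lower cover, so it is
  \<open>j\<close>.\<close>

lemma Ji_eq: "Ji L = ji ` S"
proof (intro equalityI subsetI)
  fix j assume j: "j \<in> Ji L"
  let ?l = "lower_cover L j"
  have c: "j \<in> carrier L" "?l \<in> carrier L"
    using j by (auto intro: Ji_carrier lower_cover_carrier)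
  have "\<not> j \<sqsubseteq> ?l" using j c by (metis le_antisym lower_cover_le lower_cover_neq)
  then obtain s where s: "s \<in> A j" "s \<notin> A ?l" using c by (auto simp: le_iff)
  then have sS: "s \<in> S" using A_subset c by blast
  have "ji s \<sqsubseteq> j" "\<not> ji s \<sqsubseteq> ?l" using s sS c by (auto simp: ji_le_iff)
  then have "ji s = j" using le_lower_cover[OF j] sS ji_carrier by blast
  then show "j \<in> ji ` S" using sS by blast
qed (auto simp: Ji_ji)

text \<open>A last point \<open>s\<close> of \<open>A w\<close> outside
  \<open>A (x \<sqinter> y)\<close> puts both \<open>y\<close> and \<open>z\<close> below
  \<open>mi s\<close>, hence also \<open>y \<squnion> z\<close>. But \<open>s\<close> belongs to
  \<open>A (y \<squnion> z)\<close> and not to \<open>A (mi s)\<close>.\<close>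

lemma meet_semidistributive: "meet_semidistributive L"
  unfolding meet_semidistributive_def
proof (intro ballI impI)
  fix x y z assume c: "x \<in> carrier L" "y \<in> carrier L" "z \<in> carrier L"
    and eq: "x \<sqinter> y = x \<sqinter> z"
  define w where "w = x \<sqinter> (y \<squnion> z)"
  have wc: "w \<in> carrier L" using c by (simp add: w_def)
  have Aw: "A w = A x \<inter> A (y \<squnion> z)" using c by (simp add: w_def A_meet)
  have xyz: "A x \<inter> A y = A x \<inter> A z" using eq A_meet c by metis
  have "A w \<subseteq> A (x \<sqinter> y)"
  proof (rule ccontr)
    let ?R = "\<lambda>s t. (s, t) \<in> onto \<and> s \<noteq> t"
    let ?D = "A w - A (x \<sqinter> y)"
    assume "\<not> A w \<subseteq> A (x \<sqinter> y)"
    then have "?D \<noteq> {}" by blast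
    moreover have "finite ?D" using A_subset[OF wc] finite_S finite_subset by blast
    moreover have "asymp_on ?D ?R"
      by (intro asymp_onI) (auto dest: onto_antisym)
    moreover have "transp_on ?D ?R"
      by (intro transp_onI) (blast intro: onto_trans dest: onto_antisym)
    ultimately obtain s where s: "s \<in> ?D" "\<forall>t\<in>?D. t \<noteq> s \<longrightarrow> \<not> ?R s t"
      using Finite_Set.bex_max_element[of ?D ?R] by blast
    have sS: "s \<in> S" using s(1) A_subset[OF wc] by blast
    \<comment> \<open>The closure of \<open>s\<close> stays inside \<open>A w\<close> by
      \<open>A_onto\<close>, and by maximality for \<open>?R\<close> its other members have left
      \<open>?D\<close>.\<close>
    have "A (ji s) - {s} \<subseteq> A (x \<sqinter> y)"
      using s A_onto[OF wc] sS by (auto simp: A_ji)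
    moreover have "s \<notin> A y" "s \<notin> A z" using s(1) c Aw xyz by (auto simp: A_meet)
    moreover have "A (x \<sqinter> y) \<subseteq> A y" "A (x \<sqinter> y) \<subseteq> A z" using c xyz by (auto simp: A_meet)
    ultimately have "y \<sqsubseteq> mi s" "z \<sqsubseteq> mi s"
      using le_mi[OF sS c(2)] le_mi[OF sS c(3)] by blast+
    then have "y \<squnion> z \<sqsubseteq> mi s" using c sS by (simp add: join_le mi_carrier)
    then have "s \<in> A (mi s)" using s(1) Aw c sS by (auto simp: le_iff mi_carrier)
    then show False using sS r_refl by (simp add: A_mi)
  qed
  then have "w \<sqsubseteq> x \<sqinter> y" using wc c by (simp add: le_iff)
  moreover have "x \<sqinter> y \<sqsubseteq> w"
    using c join_left[of y z] unfolding w_def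
    by (intro meet_le meet_left) (auto intro: le_trans[OF meet_right])
  ultimately show "x \<sqinter> (y \<squnion> z) = x \<sqinter> y"
    using wc c unfolding w_def by (auto intro: le_antisym)
qed

text \<open>The isomorphism is \<open>ji\<close>, injective by the order condition. For the arrow,
  \<open>ji s\<close> not below \<open>mi t\<close> means that \<open>s\<close> is not in
  \<open>A (mi t)\<close>, which says that \<open>(s, t) \<in> r\<close>.\<close>

lemma factorization_system_isomorphic_Ji:
  "factorization_system_isomorphic S r onto into (Ji L) (Ji_arrow L) (Ji_onto L) (Ji_into L)"
proof -
  have "inj_on ji S"
  proof (rule inj_onI)
    fix s t assume st: "s \<in> S" "t \<in> S" "ji s = ji t"
    then have "{u. (s, u) \<in> onto} = {u. (t, u) \<in> onto}" by (simp flip: A_ji)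
    then have "(s, t) \<in> onto" "(t, s) \<in> onto" using st onto_refl by blast+
    then show "s = t" by (rule onto_antisym)
  qed
  then have "bij_betw ji S (Ji L)" by (simp add: bij_betw_def Ji_eq)
  moreover have "((s, t) \<in> r \<longleftrightarrow> (ji s, ji t) \<in> Ji_arrow L) \<and>
      ((s, t) \<in> onto \<longleftrightarrow> (ji s, ji t) \<in> Ji_onto L) \<and>
      ((s, t) \<in> into \<longleftrightarrow> (ji s, ji t) \<in> Ji_into L)" if "s \<in> S" "t \<in> S" for s t
    using that
    by (simp add: Ji_arrow_def Ji_onto_def Ji_into_def Ji_ji kappa_ji ji_le_iff mi_le_iff
        ji_carrier mi_carrier A_ji A_mi)
  ultimately show ?thesis unfolding factorization_system_isomorphic_def by blast
qed

end

lemma (in two_acyclic_pairs_lattice) semidistributive_lattice: "semidistributive_lattice L"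
proof -
  interpret d: two_acyclic_pairs_lattice "inv_gorder L" S "r\<inverse>" "into\<inverse>" "onto\<inverse>" B A
    by (rule dual_two_acyclic_pairs_lattice)
  have "join_semidistributive L"
    using d.meet_semidistributive
    by (simp add: meet_semidistributive_def join_semidistributive_def)
  \<comment> \<open>The left perp of the empty set is \<open>S\<close>, so a pair with first
    component \<open>S\<close> always exists.\<close>
  moreover have "carrier L \<noteq> {}" using left_perp_closed[of "{}"] by blast
  ultimately show ?thesis
    by (simp add: semidistributive_lattice_def is_lattice meet_semidistributive)
qed

section \<open>Transfer along an order isomorphism, and the theorem\<close>

lemma two_acyclic_pairs_latticeI:
  assumes "partial_order L" "finite (carrier L)" "finite S"
    and "two_acyclic_factorization_system S r onto into" and f: "order_iso L (Pairs S r) f"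
  shows "two_acyclic_pairs_lattice L S r onto into (\<lambda>x. fst (f x)) (\<lambda>x. snd (f x))"
proof -
  have carr: "f ` carrier L = carrier (Pairs S r)"
    and emb: "order_emb L (Pairs S r) f"
    using f by (auto simp: order_iso_def bij_betw_def)
  have pair: "snd (f x) = right_perp S r (fst (f x))" "fst (f x) = left_perp S r (snd (f x))"
    if "x \<in> carrier L" for x
  proof -
    have "f x \<in> carrier (Pairs S r)" using that carr by blast
    then have "(fst (f x), snd (f x)) \<in> carrier (Pairs S r)" by simp
    then show "snd (f x) = right_perp S r (fst (f x))" "fst (f x) = left_perp S r (snd (f x))"
      unfolding mem_carrier_Pairs by blast+
  qed
  have exists: "\<exists>x\<in>carrier L. fst (f x) = X \<and> snd (f x) = Y"
    if XY: "Y = right_perp S r X" "X = left_perp S r Y" for X Y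
  proof -
    have "X \<subseteq> S" by (subst XY(2)) (auto simp: left_perp_def)
    moreover have "Y \<subseteq> S" by (subst XY(1)) (auto simp: right_perp_def)
    ultimately have "(X, Y) \<in> f ` carrier L" using XY unfolding carr mem_carrier_Pairs by blast
    then obtain x where "x \<in> carrier L" "f x = (X, Y)" by auto
    then show ?thesis by (intro bexI[of _ x]) simp_all
  qed
  have le: "le L x y \<longleftrightarrow> fst (f x) \<subseteq> fst (f y)" if "x \<in> carrier L" "y \<in> carrier L" for x y
    using emb that by (auto simp: order_emb_def Pairs_def)
  interpret finite_poset L
    using assms by (simp add: finite_poset_def finite_poset_axioms_def)
  show ?thesis
    using assms le pair exists by unfold_locales
qed

text \<open>The witness for the equivalence is \<open>Ji L\<close>, hence a set over
  \<open>'a\<close>; the second conjunct lets the system live over an arbitrary type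
  \<open>'b\<close>.\<close>

theorem theorem1p2:
  fixes L :: "('a, 'c) gorder_scheme"
  assumes "partial_order L" and "finite (carrier L)"
  shows
    "(semidistributive_lattice L \<longleftrightarrow>
        (\<exists>(S :: 'a set) r onto into.
          finite S \<and> two_acyclic_factorization_system S r onto into \<and>
          order_isomorphic L (Pairs S r)))
     \<and> (\<forall>(S :: 'b set) r onto into.
          finite S \<and> two_acyclic_factorization_system S r onto into \<and>
          order_isomorphic L (Pairs S r) \<longrightarrow>
            semidistributive_lattice L \<and>
            factorization_system_isomorphic S r onto into
              (Ji L) (Ji_arrow L) (Ji_onto L) (Ji_into L))
     \<and> (semidistributive_lattice L \<longrightarrow>
          (let f = (\<lambda>x. ({j \<in> Ji L. j \<sqsubseteq>\<^bsub>L\<^esub> x}, kappa_dual L ` {m \<in> Mi L. x \<sqsubseteq>\<^bsub>L\<^esub> m}));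
               P = Pairs (Ji L) (Ji_arrow L)
           in order_iso L P f
              \<and> (\<forall>(X, Y)\<in>carrier P.
                   \<Squnion>\<^bsub>L\<^esub> X = \<Sqinter>\<^bsub>L\<^esub> (kappa L ` Y) \<and>
                   \<Squnion>\<^bsub>L\<^esub> X \<in> carrier L \<and> f (\<Squnion>\<^bsub>L\<^esub> X) = (X, Y))
              \<and> (\<forall>x\<in>carrier L. \<Squnion>\<^bsub>L\<^esub> (fst (f x)) = x)))"
proof (intro conjI allI impI, goal_cases)
  case 1
  show ?case
  proof
    assume sd: "semidistributive_lattice L"
    then interpret lattice L by (simp add: semidistributive_lattice_def)
    interpret finite_semidistributive_lattice L
      using sd assms(2) by unfold_locales (auto simp: semidistributive_lattice_def)
    have "finite (Ji L)" using assms(2) by (simp add: Ji_def)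
    then show "\<exists>(S :: 'a set) r onto into.
        finite S \<and> two_acyclic_factorization_system S r onto into \<and> order_isomorphic L (Pairs S r)"
      using two_acyclic_factorization_system_Ji order_iso_Pairs
      unfolding order_isomorphic_def by blast
  next
    assume "\<exists>(S :: 'a set) r onto into.
        finite S \<and> two_acyclic_factorization_system S r onto into \<and> order_isomorphic L (Pairs S r)"
    then show "semidistributive_lattice L"
      using assms two_acyclic_pairs_latticeI two_acyclic_pairs_lattice.semidistributive_lattice
      unfolding order_isomorphic_def by metis
  qed
next
  case (2 S r onto into)
  then show ?case
    using assms two_acyclic_pairs_latticeI two_acyclic_pairs_lattice.semidistributive_lattice
    unfolding order_isomorphic_def by metis
next
  case (3 S r onto into)
  then show ?case
    using assms two_acyclic_pairs_latticeI
      two_acyclic_pairs_lattice.factorization_system_isomorphic_Ji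
    unfolding order_isomorphic_def by metis
next
  case 4
  then interpret lattice L by (simp add: semidistributive_lattice_def)
  interpret finite_semidistributive_lattice L
    using 4 assms(2) by unfold_locales (auto simp: semidistributive_lattice_def)
  let ?g = "\<lambda>x. ({j \<in> Ji L. j \<sqsubseteq>\<^bsub>L\<^esub> x}, {j \<in> Ji L. x \<sqsubseteq>\<^bsub>L\<^esub> kappa L j})"
  let ?f = "\<lambda>x. ({j \<in> Ji L. j \<sqsubseteq>\<^bsub>L\<^esub> x}, kappa_dual L ` {m \<in> Mi L. x \<sqsubseteq>\<^bsub>L\<^esub> m})"
  let ?P = "Pairs (Ji L) (Ji_arrow L)"
  have fg: "?f x = ?g x" if "x \<in> carrier L" for x
    using that kappa_dual_image by simp
  \<comment> \<open>Embedding and bijectivity depend only on values on the carrier, where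
    \<open>fg\<close> identifies the two maps.\<close>
  have "order_iso L ?P ?f"
    using order_iso_Pairs bij_betw_cong[of "carrier L" ?f ?g]
    unfolding order_iso_def order_emb_def by (simp add: fg Pairs_def)
  moreover have "\<Squnion>\<^bsub>L\<^esub> X = \<Sqinter>\<^bsub>L\<^esub> (kappa L ` Y) \<and> \<Squnion>\<^bsub>L\<^esub> X \<in> carrier L \<and> ?f (\<Squnion>\<^bsub>L\<^esub> X) = (X, Y)"
    if XY: "(X, Y) \<in> carrier ?P" for X Y
  proof -
    have p: "X \<subseteq> Ji L" "Y = right_perp (Ji L) (Ji_arrow L) X" "X = left_perp (Ji L) (Ji_arrow L) Y"
      using XY unfolding mem_carrier_Pairs by blast+
    have c: "\<Squnion>\<^bsub>L\<^esub> X \<in> carrier L"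
      using sup_least[of X] p(1) Ji_carrier by blast
    then show ?thesis
      using perp_pair_sup[OF p] inf_kappa_above[OF c] fg[OF c] by simp
  qed
  moreover have "\<forall>x\<in>carrier L. \<Squnion>\<^bsub>L\<^esub> (fst (?f x)) = x"
    by (simp add: sup_Ji_below)
  ultimately show ?case unfolding Let_def by blast
qed

end
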